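(* Let $k\le m$ be positive integers and $n=\frac{m}{\gcd(m,k)}$. For $i\in[n]$ let $B_i=\{(j \bmod m)+1: j\in[(i-1)k,\,ik-1]\}\subseteq[m]$, and for $j\in[m]$ let $C_j=\{i\in[n]: j\in B_i\}$. Then $\{C_1,\dots,C_m\}$ is a regular $(n,nk,k,m;k)$-MCBC, in which every server stores exactly $\frac{k}{\gcd(m,k)}$ items.
   Context: An $(n,N,k,m;r)$ multiset combinatorial batch code (MCBC) is a collection $\mathcal C=\{C_1,\dots,C_m\}$ of subsets of $[n]=\{1,\dots,n\}$ (servers) with $N=\sum_{j=1}^m|C_j|$, such that for every multiset request $\{i_1,\dots,i_k\}$ of $k$ elements of $[n]$ in which every element has multiplicity at most $r$, there exist subsets $D_j\subseteq C_j$ with $|D_j|\le 1$ ($j\in[m]$) whose multiset union (the multiplicity of $i$ being $|\{j: i\in D_j\}|$) contains the request. An MCBC is regular if all servers store the same number of items, i.e. $|C_1|=\dots=|C_m|$. Here $j\bmod m\in\{0,\dots,m-1\}$ and $[a,b]=\{a,\dots,b\}$. *)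

theory Defs
  imports Main "HOL-Library.Multiset"
begin

(* The collection is an indexed family: C j is used only for j in {1..m}, and
   repeated servers are allowed. *)
definition mcbc :: "nat \<Rightarrow> nat \<Rightarrow> nat \<Rightarrow> nat \<Rightarrow> nat \<Rightarrow> (nat \<Rightarrow> nat set) \<Rightarrow> bool" where
  "mcbc n N k m r C \<longleftrightarrow>
     (\<forall>j\<in>{1..m}. C j \<subseteq> {1..n}) \<and>
     N = (\<Sum>j\<in>{1..m}. card (C j)) \<and>
     (\<forall>R :: nat multiset.
        set_mset R \<subseteq> {1..n} \<and> size R = k \<and> (\<forall>i. count R i \<le> r) \<longrightarrow>
        (\<exists>D :: nat \<Rightarrow> nat set.
           (\<forall>j\<in>{1..m}. D j \<subseteq> C j \<and> card (D j) \<le> 1) \<and>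
           R \<subseteq># (\<Sum>j\<in>{1..m}. mset_set (D j))))"

definition regular_mcbc :: "nat \<Rightarrow> nat \<Rightarrow> nat \<Rightarrow> nat \<Rightarrow> nat \<Rightarrow> (nat \<Rightarrow> nat set) \<Rightarrow> bool" where
  "regular_mcbc n N k m r C \<longleftrightarrow>
     mcbc n N k m r C \<and> (\<forall>j\<in>{1..m}. \<forall>j'\<in>{1..m}. card (C j) = card (C j'))"

end

(* Both claims rest on B i being a cyclic arc of k <= m servers. A request has only k entries, so
   serving them greedily never fails: when an entry i is treated, fewer than k servers are busy,
   hence one of the k servers storing i is idle. For the load of a server, the intervals
   [(i-1)k, ik-1] tile [0, nk-1], where nk = lcm(m,k), and each meets every residue class mod m at
   most once; so the load of server j counts the t < nk with t mod m = j - 1. *)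
theory Submission imports Defs begin

text \<open>Asking for equality with the sum, not mere inclusion, strengthens the induction: exactly
  \<open>size R\<close> servers are busy after \<open>R\<close> has been served. The next entry
  \<open>x\<close> is stored on at least \<open>size R + 1\<close> servers, so one of them is
  idle.\<close>

lemma greedy_service:
  assumes "finite M" and "\<And>i. i \<in># R \<Longrightarrow> size R \<le> card {j \<in> M. i \<in> C j}"
  shows "\<exists>D. (\<forall>j\<in>M. D j = {} \<or> (\<exists>x\<in>C j. D j = {x})) \<and> R = (\<Sum>j\<in>M. mset_set (D j))"
  using assms(2)
proof (induction R)
  case empty
  show ?case by (rule exI[of _ "\<lambda>_. {}"]) simp
next
  case (add x R)
  have "size R \<le> card {j \<in> M. i \<in> C j}" if "i \<in># R" for i
    using add.prems[of i] that by simp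
  then obtain D where D: "\<forall>j\<in>M. D j = {} \<or> (\<exists>x\<in>C j. D j = {x})"
    and R: "R = (\<Sum>j\<in>M. mset_set (D j))" using add.IH by blast
  let ?busy = "{j \<in> M. D j \<noteq> {}}"
  have "size R = (\<Sum>j\<in>M. card (D j))" by (simp add: R size_multiset_sum)
  also have "\<dots> = (\<Sum>j\<in>M. if D j \<noteq> {} then 1 else 0)"
    by (rule sum.cong) (use D in auto)
  also have "\<dots> = card ?busy"
    using \<open>finite M\<close> by (simp add: sum.If_cases Int_def conj_commute)
  finally have "card ?busy < card {j \<in> M. x \<in> C j}" using add.prems[of x] by simp
  then have "\<not> {j \<in> M. x \<in> C j} \<subseteq> ?busy"
    using card_mono[of ?busy "{j \<in> M. x \<in> C j}"] \<open>finite M\<close> by auto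
  then obtain j where j: "j \<in> M" "x \<in> C j" "D j = {}" by blast
  let ?D = "D(j := {x})"
  have "(\<Sum>i\<in>M. mset_set (?D i)) = {#x#} + (\<Sum>i\<in>M - {j}. mset_set (?D i))"
    using j \<open>finite M\<close> by (simp add: sum.remove)
  also have "(\<Sum>i\<in>M - {j}. mset_set (?D i)) = (\<Sum>i\<in>M - {j}. mset_set (D i))"
    by (rule sum.cong) auto
  also have "\<dots> = R" using j \<open>finite M\<close> by (simp add: R sum.remove)
  finally have "add_mset x R = (\<Sum>i\<in>M. mset_set (?D i))" by simp
  moreover have "\<forall>i\<in>M. ?D i = {} \<or> (\<exists>x\<in>C i. ?D i = {x})" using D j by auto
  ultimately show ?case by blast
qed

text \<open>Reduces the service property to counting, for each item, the servers that store
  it.\<close>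

lemma mcbc_if_stored_k_times:
  assumes C: "\<And>j. j \<in> {1..m} \<Longrightarrow> C j \<subseteq> {1..n}"
    and k: "\<And>i. i \<in> {1..n} \<Longrightarrow> card {j \<in> {1..m}. i \<in> C j} = k"
    and N: "N = (\<Sum>j\<in>{1..m}. card (C j))"
  shows "mcbc n N k m r C"
  unfolding mcbc_def
proof (intro conjI allI impI)
  fix R :: "nat multiset"
  assume R: "set_mset R \<subseteq> {1..n} \<and> size R = k \<and> (\<forall>i. count R i \<le> r)"
  then have "size R \<le> card {j \<in> {1..m}. i \<in> C j}" if "i \<in># R" for i
    using that k[of i] by auto
  from greedy_service[OF _ this] obtain D where
    D: "\<forall>j\<in>{1..m}. D j = {} \<or> (\<exists>x\<in>C j. D j = {x})" "R = (\<Sum>j\<in>{1..m}. mset_set (D j))"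
    by blast
  have "D j \<subseteq> C j \<and> card (D j) \<le> 1" if "j \<in> {1..m}" for j
    using D(1) that by fastforce
  with D(2) show "\<exists>D. (\<forall>j\<in>{1..m}. D j \<subseteq> C j \<and> card (D j) \<le> 1) \<and>
      R \<subseteq># (\<Sum>j\<in>{1..m}. mset_set (D j))" by (intro exI[of _ D]) auto
qed (use C N in auto)

text \<open>Two distinct elements of the interval differ by less than \<open>k\<close>, hence by
  less than \<open>m\<close>, so \<open>m\<close> cannot divide their difference.\<close>

lemma inj_on_mod_interval:
  fixes a k m :: nat
  assumes "k \<le> m"
  shows "inj_on (\<lambda>t. t mod m) {a..<a + k}"
proof (rule linorder_inj_onI')
  fix s t assume st: "s \<in> {a..<a + k}" "t \<in> {a..<a + k}" "s < t"
  show "s mod m \<noteq> t mod m"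
  proof
    assume "s mod m = t mod m"
    then have "m dvd t - s" using st by (metis less_imp_le mod_eq_dvd_iff_nat)
    then have "m \<le> t - s" using st by (simp add: dvd_imp_le)
    then show False using st assms by auto
  qed
qed

text \<open>The range below \<open>m * q\<close> consists of \<open>q\<close> full periods, each
  containing the residue \<open>r\<close> once; \<open>t div m\<close> numbers the periods.\<close>

lemma card_residue_class_below_mult:
  fixes m q r :: nat
  assumes "r < m"
  shows "card {t. t < m * q \<and> t mod m = r} = q"
proof -
  have "{t. t < m * q \<and> t mod m = r} = (\<lambda>s. m * s + r) ` {..<q}"
  proof (intro set_eqI iffI)
    fix t assume "t \<in> {t. t < m * q \<and> t mod m = r}"
    then have "t div m < q" "t = m * (t div m) + r"
      by (auto simp: less_mult_imp_div_less mult.commute)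
    then show "t \<in> (\<lambda>s. m * s + r) ` {..<q}" by blast
  next
    fix t assume "t \<in> (\<lambda>s. m * s + r) ` {..<q}"
    then obtain s where s: "s < q" "t = m * s + r" by auto
    then have "t < m * Suc s" using assms by simp
    also have "\<dots> \<le> m * q" using s by (intro mult_le_mono2) simp
    finally show "t \<in> {t. t < m * q \<and> t mod m = r}" using s assms by simp
  qed
  moreover have "inj_on (\<lambda>s. m * s + r) {..<q}" using assms by (auto simp: inj_on_def)
  ultimately show ?thesis by (simp add: card_image)
qed

theorem theorem14:
  fixes k m n :: nat and B C :: "nat \<Rightarrow> nat set"
  assumes "0 < k" and "k \<le> m"
    and "n = m div gcd m k"
    and "\<And>i. i \<in> {1..n} \<Longrightarrow> B i = {(j mod m) + 1 | j. j \<in> {(i - 1) * k..i * k - 1}}"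
    and "\<And>j. j \<in> {1..m} \<Longrightarrow> C j = {i \<in> {1..n}. j \<in> B i}"
  shows "regular_mcbc n (n * k) k m k C \<and> (\<forall>j\<in>{1..m}. card (C j) = k div gcd m k)"
proof -
  let ?q = "k div gcd m k"
  let ?I = "\<lambda>i. {(i - 1) * k..<(i - 1) * k + k}"
  \<comment> \<open>Both sides equal lcm(m,k), so the \<open>n\<close> intervals together cover
    exactly \<open>?q\<close> full periods of length \<open>m\<close>.\<close>
  have nk: "n * k = m * ?q"
    using assms(3) by (simp add: div_mult_swap dvd_div_mult)
  \<comment> \<open>The half-open form fits \<open>inj_on_mod_interval\<close>. With
    \<open>i\<close> and \<open>k\<close> positive, neither subtraction in the original bounds
    truncates.\<close>
  have B: "B i = (\<lambda>t. t mod m + 1) ` ?I i" if "i \<in> {1..n}" for i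
  proof -
    have "(i - 1) * k + k = i * k" using that by (cases i) auto
    then have "{(i - 1) * k..i * k - 1} = ?I i" using \<open>0 < k\<close> by auto
    then show ?thesis using assms(4)[OF that] by auto
  qed
  have inj: "inj_on (\<lambda>t. t mod m + 1) (?I i)" for i
    using inj_on_mod_interval[OF \<open>k \<le> m\<close>, of "(i - 1) * k"] by (simp add: inj_on_def)
  \<comment> \<open>The tiling: \<open>?I i\<close> is the fibre of \<open>t div k + 1\<close> over
    \<open>i\<close>, so each \<open>t\<close> below \<open>n * k\<close> lies in exactly one
    interval.\<close>
  have interval: "t \<in> ?I i \<longleftrightarrow> t div k + 1 = i" if "i \<in> {1..n}" for i t
  proof -
    from that obtain l where l: "i = Suc l" by (cases i) auto
    have "t div k = l \<longleftrightarrow> l * k \<le> t \<and> t < l * k + k"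
      using dividend_less_times_div[OF \<open>0 < k\<close>, of t]
      by (auto intro!: div_nat_eqI simp: mult.commute)
    then show ?thesis using l by auto
  qed
  have load: "card (C j) = ?q" if j: "j \<in> {1..m}" for j
  proof -
    let ?T = "{t. t < m * ?q \<and> t mod m = j - 1}"
    \<comment> \<open>Since \<open>m * ?q = n * k\<close>, the bound on \<open>t\<close> says
      exactly that its interval number is a valid item.\<close>
    have T: "t \<in> ?T \<longleftrightarrow> t div k + 1 \<in> {1..n} \<and> t mod m + 1 = j" for t
      using j \<open>0 < k\<close> by (auto simp: nk[symmetric] div_less_iff_less_mult Suc_le_eq)
    have "C j = (\<lambda>t. t div k + 1) ` ?T"
    proof (intro set_eqI iffI)
      fix i assume "i \<in> C j"
      then have i: "i \<in> {1..n}" "j \<in> B i" using assms(5)[OF j] by auto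
      then obtain t where t: "t \<in> ?I i" "t mod m + 1 = j" unfolding B[OF i(1)] by blast
      have "t div k + 1 = i" using interval[OF i(1)] t(1) by blast
      moreover from this have "t \<in> ?T" unfolding T using i(1) t(2) by simp
      ultimately show "i \<in> (\<lambda>t. t div k + 1) ` ?T" by blast
    next
      fix i assume "i \<in> (\<lambda>t. t div k + 1) ` ?T"
      then obtain t where "t \<in> ?T" "i = t div k + 1" by (rule imageE)
      then have t: "i = t div k + 1" "i \<in> {1..n}" "t mod m + 1 = j"
        using T[of t] by simp_all
      have "t \<in> ?I i" using interval[OF t(2)] t(1) by blast
      then have "j \<in> B i" unfolding B[OF t(2)] using t(3) by blast
      then show "i \<in> C j" using t(2) assms(5)[OF j] by blast
    qed
    \<comment> \<open>Elements of \<open>?T\<close> with the same interval number share an interval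
      and a residue, so \<open>inj\<close> identifies them.\<close>
    moreover have "inj_on (\<lambda>t. t div k + 1) ?T"
    proof (rule inj_onI)
      fix s t assume st: "s \<in> ?T" "t \<in> ?T" "s div k + 1 = t div k + 1"
      let ?i = "t div k + 1"
      have i: "?i \<in> {1..n}" "s mod m + 1 = t mod m + 1"
        using st(1,2) T[of s] T[of t] by simp_all
      have "s \<in> ?I ?i" "t \<in> ?I ?i" using interval[OF i(1)] st(3) by blast+
      with i(2) show "s = t" by (rule inj_onD[OF inj])
    qed
    ultimately have "card (C j) = card ?T" by (simp add: card_image)
    also have "\<dots> = ?q" using j by (intro card_residue_class_below_mult) auto
    finally show ?thesis .
  qed
  have "card {j \<in> {1..m}. i \<in> C j} = k" if i: "i \<in> {1..n}" for i
  proof -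
    \<comment> \<open>Residues shifted by one lie in \<open>{1..m}\<close>, so restricting to actual
      servers removes nothing from the arc \<open>B i\<close>.\<close>
    have "B i \<subseteq> {1..m}" using \<open>0 < k\<close> \<open>k \<le> m\<close> by (auto simp: B[OF i] Suc_le_eq)
    then have "{j \<in> {1..m}. i \<in> C j} = B i" using i assms(5) by blast
    then show ?thesis using B[OF i] inj by (simp add: card_image)
  qed
  moreover have "C j \<subseteq> {1..n}" if "j \<in> {1..m}" for j using assms(5)[OF that] by blast
  moreover have "n * k = (\<Sum>j\<in>{1..m}. card (C j))" by (simp add: load nk)
  ultimately have "mcbc n (n * k) k m k C" by (intro mcbc_if_stored_k_times)
  then show ?thesis using load by (simp add: regular_mcbc_def)
qed

end
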